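(* Let $I\subset[0,+\infty)$ be an interval with $\inf I=0$, and let $f\colon I\to\mathbb{R}$ be continuous and strictly monotone. If there exists $\varepsilon\in I$ with $\varepsilon>0$ such that $\mathscr{A}^{[f]}|_{(0,\varepsilon)}$ is a weak-Hardy mean, then $\mathscr{A}^{[f]}$ is a weak-Hardy mean (on $I$).
   Context: For an interval $I$ and a continuous, strictly monotone function $f\colon I\to\mathbb{R}$, the quasi-arithmetic mean $\mathscr{A}^{[f]}$ on $I$ is $\mathscr{A}^{[f]}(a_1,\dots,a_n)=f^{-1}\big(\tfrac{f(a_1)+\cdots+f(a_n)}{n}\big)$ for $n\in\mathbb{N}$ and $(a_1,\dots,a_n)\in I^n$. For a subinterval $J\subset I$, $\mathscr{A}^{[f]}|_J$ denotes the restriction of $\mathscr{A}^{[f]}$ to $\bigcup_{n=1}^\infty J^n$; it is a mean on $J$. For an interval $I\subset[0,+\infty)$, $\ell_1(I)$ denotes the set of summable sequences with all terms in $I$. A mean $\mathscr{M}\colon\bigcup_{n=1}^\infty I^n\to I$ on $I$ is a weak-Hardy mean if $\sum_{n=1}^\infty \mathscr{M}(a_1,\dots,a_n)<+\infty$ for all $a\in\ell_1(I)$. *)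

theory Defs
  imports "HOL-Analysis.Analysis"
begin

definition tuples :: "real set \<Rightarrow> real list set" where
  "tuples I = {xs. xs \<noteq> [] \<and> set xs \<subseteq> I}"

text \<open>The inverse is that of \<open>f\<close> regarded as a function on \<open>I\<close> only.\<close>

definition quasi_arith_mean :: "real set \<Rightarrow> (real \<Rightarrow> real) \<Rightarrow> real list \<Rightarrow> real" where
  "quasi_arith_mean I f = (\<lambda>xs\<in>tuples I. inv_into I f (sum_list (map f xs) / real (length xs)))"

definition mean_on :: "real set \<Rightarrow> (real list \<Rightarrow> real) \<Rightarrow> bool" where
  "mean_on I M \<longleftrightarrow> M \<in> tuples I \<rightarrow> I \<and>
     (\<forall>xs\<in>tuples I. Min (set xs) \<le> M xs \<and> M xs \<le> Max (set xs))"

definition l1_on :: "real set \<Rightarrow> (nat \<Rightarrow> real) set" where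
  "l1_on I = {a. range a \<subseteq> I \<and> summable a}"

text \<open>
  Intended for intervals \<open>I \<subseteq> {0..}\<close>, where all terms are nonnegative, so that summability
  expresses finiteness of the sum.  Sequences are indexed from \<open>0\<close>: \<open>a 0, \<dots>, a n\<close> are the
  first \<open>n + 1\<close> terms.
\<close>

definition weak_hardy_mean :: "real set \<Rightarrow> (real list \<Rightarrow> real) \<Rightarrow> bool" where
  "weak_hardy_mean I M \<longleftrightarrow> mean_on I M \<and>
     (\<forall>a\<in>l1_on I. summable (\<lambda>n. M (map a [0..<Suc n])))"

end

(* Replacing f by -f does not change the mean, so let f be increasing.  Raise a given summable
   sequence to a positive one, fix 0 < c < \<epsilon>, and replace its first N terms by c, which gives
   a summable sequence in (0, \<epsilon>).  The values f(a_i) eventually stay below f(c) by a fixed positive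
   amount, so for large N the sum of f(c) - f(a_i) over i < N is nonnegative.  For such N the
   replacement only increases the means of length at least N. *)

theory Submission
  imports Defs
begin

text \<open>The conditions \<open>- f x = - y\<close> and \<open>f x = y\<close> coincide, so
  \<open>inv_into\<close> chooses the same point for both functions, for every \<open>y\<close>.
  This reduces the decreasing case to the increasing one.\<close>

lemma quasi_arith_mean_uminus:
  "quasi_arith_mean I (\<lambda>x. - f x) = quasi_arith_mean I f"
proof -
  have "inv_into I (\<lambda>x. - f x) (- y) = inv_into I f y" for y
    by (simp add: inv_into_def)
  moreover have "(\<Sum>x\<leftarrow>xs. - f x) = - sum_list (map f xs)" for xs
    by (induction xs) auto
  ultimately show ?thesis
    unfolding quasi_arith_mean_def by (intro restrict_ext) simp
qed

lemma sum_list_map_bounds: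
  fixes f :: "real \<Rightarrow> real"
  assumes "\<And>x. x \<in> set xs \<Longrightarrow> l \<le> f x \<and> f x \<le> u"
  shows "real (length xs) * l \<le> sum_list (map f xs) \<and> sum_list (map f xs) \<le> real (length xs) * u"
  using assms by (induction xs) (auto simp: algebra_simps intro: add_mono)

context
  fixes I :: "real set" and f :: "real \<Rightarrow> real"
  assumes I: "is_interval I" and cont: "continuous_on I f" and mono: "strict_mono_on I f"
begin

lemma quasi_arith_mean_characterization:
  assumes "xs \<in> tuples I"
  shows "quasi_arith_mean I f xs \<in> I"
    and "f (quasi_arith_mean I f xs) = sum_list (map f xs) / real (length xs)"
    and "Min (set xs) \<le> quasi_arith_mean I f xs"
    and "quasi_arith_mean I f xs \<le> Max (set xs)"
proof -
  let ?m = "Min (set xs)" and ?M = "Max (set xs)"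
  let ?v = "sum_list (map f xs) / real (length xs)"
  from assms have ne: "xs \<noteq> []" and sub: "set xs \<subseteq> I" by (auto simp: tuples_def)
  then have mI: "?m \<in> I" "?M \<in> I" by (meson Min_in Max_in List.finite_set set_empty subsetD)+
  have "f ?m \<le> f x \<and> f x \<le> f ?M" if "x \<in> set xs" for x
    using that sub mI mono by (auto simp: strict_mono_on_leD)
  from sum_list_map_bounds[OF this] ne have bounds: "f ?m \<le> ?v" "?v \<le> f ?M"
    by (auto simp: field_simps)
  have "is_interval (f ` I)"
    using I cont by (simp add: is_interval_connected_1 connected_continuous_image)
  then have v: "?v \<in> f ` I"
    using mI bounds by (meson imageI mem_is_interval_1_I)
  have eq: "quasi_arith_mean I f xs = inv_into I f ?v"
    using assms by (simp add: quasi_arith_mean_def)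
  show 1: "quasi_arith_mean I f xs \<in> I"
    using v by (simp add: eq inv_into_into)
  show 2: "f (quasi_arith_mean I f xs) = ?v"
    using v by (simp add: eq f_inv_into_f)
  show "?m \<le> quasi_arith_mean I f xs" "quasi_arith_mean I f xs \<le> ?M"
    using bounds 1 2 mI mono by (simp_all flip: strict_mono_on_less_eq[OF mono])
qed

lemma mean_on_quasi_arith_mean: "mean_on I (quasi_arith_mean I f)"
  by (auto simp: mean_on_def quasi_arith_mean_characterization)

lemma quasi_arith_mean_mono:
  assumes "xs \<in> tuples I" "ys \<in> tuples I" "length xs = length ys"
    and "sum_list (map f xs) \<le> sum_list (map f ys)"
  shows "quasi_arith_mean I f xs \<le> quasi_arith_mean I f ys"
  using assms
  by (simp flip: strict_mono_on_less_eq[OF mono]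
        add: quasi_arith_mean_characterization divide_right_mono)

lemma weak_hardy_mean_if_restrict_mono:
  assumes nonneg: "I \<subseteq> {0..}" and inf: "Inf I = 0" and e: "\<epsilon> \<in> I" "\<epsilon> > 0"
    and wh: "weak_hardy_mean {0<..<\<epsilon>} (restrict (quasi_arith_mean I f) (tuples {0<..<\<epsilon>}))"
  shows "weak_hardy_mean I (quasi_arith_mean I f)"
  unfolding weak_hardy_mean_def
proof (intro conjI ballI mean_on_quasi_arith_mean)
  let ?A = "quasi_arith_mean I f"
  fix a assume "a \<in> l1_on I"
  then have aI: "\<And>n. a n \<in> I" and suma: "summable a" by (auto simp: l1_on_def)
  \<comment> \<open>As \<open>Inf I = 0\<close>, some point of \<open>I\<close> lies below any
    positive \<open>x\<close>, and \<open>I\<close> is an interval. Whether 0 belongs to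
    \<open>I\<close> is left open.\<close>
  have subI: "x \<in> I" if "0 < x" "x \<le> \<epsilon>" for x
  proof -
    obtain y where "y \<in> I" "y < x" using cInf_lessD[of I x] e inf \<open>0 < x\<close> by auto
    then show ?thesis using I e that by (meson less_imp_le mem_is_interval_1_I)
  qed
  define c where "c = \<epsilon> / 2"
  have c: "0 < c" "c < \<epsilon>" using e by (auto simp: c_def)
  \<comment> \<open>Terms of \<open>a\<close> may be 0, which \<open>{0<..<\<epsilon>}\<close>
    excludes. The geometric floor makes them positive; the maximum is at most the sum, so
    summability survives.\<close>
  define a' where "a' n = max (a n) (c * (1/2)^n)" for n
  have cn: "0 < c * (1/2)^n" "c * (1/2)^n \<le> \<epsilon>" for n :: nat
  proof -
    have "c * (1/2)^n \<le> c"
      using c by (intro mult_left_le power_le_one) auto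
    then show "0 < c * (1/2)^n" "c * (1/2)^n \<le> \<epsilon>"
      using c by (simp, linarith)
  qed
  have a'I: "a' n \<in> I" and a'pos: "a' n > 0" and a'ge: "a n \<le> a' n" for n
    using aI[of n] subI[OF cn[of n]] cn[of n] by (auto simp: a'_def max_def)
  have suma': "summable a'"
  proof (rule summable_comparison_test')
    show "summable (\<lambda>n. a n + c * (1/2)^n)"
      using suma by (intro summable_add summable_mult summable_geometric) auto
    show "norm (a' n) \<le> a n + c * (1/2)^n" if "n \<ge> 0" for n
      using aI[of n] nonneg cn[of n] by (auto simp: a'_def)
  qed
  \<comment> \<open>The threshold is \<open>c / 2\<close> instead of \<open>c\<close> so that
    \<open>f c - f (a' n)\<close> is bounded below by one positive constant
    \<open>d\<close>.\<close>
  have "\<forall>\<^sub>F n in sequentially. a' n < c / 2"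
    using summable_LIMSEQ_zero[OF suma'] c by (auto dest: order_tendstoD(2)[of _ _ _ "c/2"])
  then obtain K where K: "\<And>n. n \<ge> K \<Longrightarrow> a' n < c / 2"
    by (auto simp: eventually_sequentially)
  define d where "d = f c - f (c / 2)"
  have d: "d > 0"
    using strict_mono_onD[OF mono, of "c/2" c] c subI by (auto simp: d_def)
  have step: "d \<le> f c - f (a' n)" if "n \<ge> K" for n
    using strict_mono_on_leD[OF mono, of "a' n" "c/2"] K[OF that] a'I c subI[of "c/2"]
    by (auto simp: d_def)
  \<comment> \<open>\<open>S n\<close> is the change in the sum of \<open>f\<close> when the first
    \<open>n\<close> terms of \<open>a'\<close> become \<open>c\<close>. Early terms may exceed
    \<open>c\<close>, so \<open>S K\<close> can be negative; from \<open>K\<close> on, each step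
    adds at least \<open>d\<close>.\<close>
  define S where "S n = (\<Sum>i<n. f c - f (a' i))" for n
  have S: "S K + real m * d \<le> S (K + m)" for m
  proof (induction m)
    case (Suc m)
    then show ?case using step[of "K + m"] by (simp add: S_def algebra_simps)
  qed simp
  obtain m where "- S K \<le> real m * d"
    using reals_Archimedean3[OF d] less_imp_le by blast
  define N where "N = K + m"
  have SN: "0 \<le> S N" using S[of m] \<open>- S K \<le> real m * d\<close> by (simp add: N_def)
  \<comment> \<open>Since \<open>N\<close> is at least \<open>K\<close>, the terms of
    \<open>a'\<close> that are kept lie below \<open>c / 2\<close>, hence below
    \<open>\<epsilon>\<close>.\<close>
  define b where "b n = (if n < N then c else a' n)" for n
  have bE: "b n \<in> {0<..<\<epsilon>}" for n
    using K[of n] a'pos c by (auto simp: b_def N_def)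
  have bI: "b n \<in> I" for n using bE[of n] subI by auto
  have sumb: "summable b"
  proof -
    have "\<forall>\<^sub>F n in sequentially. b n = a' n"
      by (auto simp: b_def eventually_sequentially intro: exI[of _ N])
    then show ?thesis using suma' by (simp add: summable_cong)
  qed
  have le: "(\<Sum>i<n. f (a i)) \<le> (\<Sum>i<n. f (b i))" if "n \<ge> N" for n
  proof -
    have "(\<Sum>i<n. f (a i)) \<le> (\<Sum>i<n. f (a' i))"
      by (intro sum_mono strict_mono_on_leD[OF mono] aI a'I a'ge)
    \<comment> \<open>At \<open>n = N\<close> this is \<open>0 \<le> S N\<close>; beyond
      \<open>N\<close> both sides gain the same terms.\<close>
    also have "\<dots> \<le> (\<Sum>i<n. f (b i))"
      using that
    proof (induction n rule: dec_induct)
      case base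
      show ?case using SN by (simp add: S_def b_def sum_subtractf)
    qed (simp add: b_def)
    finally show ?thesis .
  qed
  have tuplesI: "map g [0..<Suc n] \<in> tuples J" if "\<And>i. g i \<in> J" for g J n
    using that by (auto simp: tuples_def)
  show "summable (\<lambda>n. ?A (map a [0..<Suc n]))"
  proof (rule summable_comparison_test')
    have "b \<in> l1_on {0<..<\<epsilon>}" using bE sumb by (auto simp: l1_on_def)
    with wh[unfolded weak_hardy_mean_def]
    have "summable (\<lambda>n. restrict ?A (tuples {0<..<\<epsilon>}) (map b [0..<Suc n]))"
      by (rule conjunct2[THEN bspec])
    then show "summable (\<lambda>n. ?A (map b [0..<Suc n]))"
      by (simp only: restrict_apply' tuplesI[OF bE])
    \<comment> \<open>The lists have \<open>n + 1\<close> entries, so \<open>le\<close> is applied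
      at \<open>Suc n\<close>.\<close>
    fix n assume n: "n \<ge> N"
    have "?A (map a [0..<Suc n]) \<le> ?A (map b [0..<Suc n])"
    proof (rule quasi_arith_mean_mono)
      show "sum_list (map f (map a [0..<Suc n])) \<le> sum_list (map f (map b [0..<Suc n]))"
        using le[of "Suc n"] n
        by (simp only: map_map interv_sum_list_conv_sum_set_nat set_upt o_def lessThan_atLeast0)
    qed (rule tuplesI aI bI | simp only: length_map)+
    moreover have "?A (map a [0..<Suc n]) \<ge> 0"
      using subsetD[OF nonneg quasi_arith_mean_characterization(1)[OF tuplesI[OF aI]]]
      by (simp only: atLeast_iff)
    ultimately show "norm (?A (map a [0..<Suc n])) \<le> ?A (map b [0..<Suc n])"
      by (simp only: real_norm_def abs_of_nonneg)
  qed
qed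

end

theorem theorem2:
  fixes I :: "real set" and f :: "real \<Rightarrow> real"
  assumes "is_interval I" and "I \<subseteq> {0..}" and "I \<noteq> {}" and "Inf I = 0"
    and "continuous_on I f"
    and "strict_mono_on I f \<or> strict_antimono_on I f"
    and "\<exists>\<epsilon>\<in>I. \<epsilon> > 0 \<and>
           weak_hardy_mean {0<..<\<epsilon>} (restrict (quasi_arith_mean I f) (tuples {0<..<\<epsilon>}))"
  shows "weak_hardy_mean I (quasi_arith_mean I f)"
proof -
  from assms(7) obtain \<epsilon> where e: "\<epsilon> \<in> I" "\<epsilon> > 0"
    and wh: "weak_hardy_mean {0<..<\<epsilon>} (restrict (quasi_arith_mean I f) (tuples {0<..<\<epsilon>}))"
    by blast
  from assms(6) show ?thesis
  proof
    assume "strict_mono_on I f"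
    from weak_hardy_mean_if_restrict_mono[OF assms(1,5) this assms(2,4) e wh] show ?thesis .
  next
    assume "strict_antimono_on I f"
    then have "strict_mono_on I (\<lambda>x. - f x)" by (simp add: monotone_on_def)
    from weak_hardy_mean_if_restrict_mono[OF assms(1) continuous_on_minus[OF assms(5)] this
        assms(2,4) e] wh
    show ?thesis by (simp only: quasi_arith_mean_uminus)
  qed
qed

end
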